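(* For every permutation $\pi$ of $\{1,\dots,n\}$, the Rosenstiehl–Tarjan–Modified algorithm run on $\pi$ returns TRUE if and only if $\pi$ can be sorted on a deque.
   Context: Sorting on a deque: a state consists of the output, the deque and the input. Initially the output and deque are empty and the input is $\pi$. Allowed operations: move the first input element to the left end or to the right end of the deque; move the left end or the right end element of a nonempty deque to the end of the output. $\pi$ is sortable on a deque if some sequence of these operations ends with output $1,2,\dots,n$. Twinstacks: a twinstack $[L,R]$ is a pair of stacks (left stack $L$, right stack $R$), not both empty, each containing elements strictly increasing from top to bottom. Reversing a twinstack swaps $L$ and $R$. A pile is a stack of twinstacks; welding the top twinstack $[L_1,R_1]$ onto the second twinstack $[L_2,R_2]$ replaces both by the single twinstack whose left stack is $L_1$ placed on top of $L_2$ and whose right stack is $R_1$ placed on top of $R_2$. The Rosenstiehl–Tarjan–Modified algorithm maintains an output list $O$ (initially empty), a pile $P$ (initially empty) and an input list $I$ (initially $\pi$). While $I$ is nonempty it performs three steps; when $I$ becomes empty it returns TRUE. (1) FromInput: remove the first element $x$ of $I$ and push the twinstack $[(x),()]$ on top of $P$. (2) Normalize: let $T$ be the top twinstack and $T_2$ the second one. If there is no $T_2$, the step succeeds. Otherwise let $x$ be the top element of the left stack of $T$, and: (i) if the right stack of $T_2$ is nonempty and $x$ is smaller than both top elements of $T_2$, succeed; (ii) if the right stack of $T_2$ is nonempty and $x$ lies between the two top elements of $T_2$, reverse $T$ if necessary so that $x$ lies over the side of $T_2$ whose top element is larger than $x$, weld $T$ onto $T_2$, and succeed; (iii) if the right stack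 of $T_2$ is nonempty and $x$ is larger than both its top elements, the algorithm returns FALSE; (iv) if the right stack of $T_2$ is empty and $x$ is smaller than the top of the left stack of $T_2$, succeed; (v) if the right stack of $T_2$ is empty and $x$ is larger than the top of the left stack of $T_2$: if $T_2$ is the bottom twinstack of the pile and $x$ is larger than every element of $T_2$, remove $x$ from $T$, place it at the bottom of the left stack of $T_2$, then (if $T$ is still nonempty) reverse $T$ and weld it onto $T_2$ (removing $T$ if it became empty), and succeed; otherwise reverse $T_2$, weld $T$ onto $T_2$, and repeat the Normalize step. (3) ToOutput: repeatedly, let $T$ be the top twinstack and $c$ the next element required by the output ($c=1+{}$the number of elements in $O$). If the top of the right stack of $T$ equals $c$, move it to the end of $O$; otherwise, if the top of the left stack of $T$ equals $c$, move it to the end of $O$; otherwise stop this step. After such a move, remove $T$ if it is empty, and otherwise reverse $T$ if necessary so that the larger of its two top elements is on its left stack; moreover, if the element was popped from the right stack of the bottom twinstack of the pile and, after the pop, that twinstack is monotonic (one of its stacks is empty, or one of its stacks consists of a single element larger than every element of the other stack), rearrange it to be one-sided by moving that single largest element to the bottom of the stack containing the other elements. *)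

theory Defs
  imports Main "HOL-Combinatorics.Multiset_Permutations"
begin

section \<open>Sorting on a deque\<close>

text \<open>A state consists of the output, the deque (its head is the left end) and the input.\<close>

type_synonym deque_state = "nat list \<times> nat list \<times> nat list"

inductive deque_step :: "deque_state \<Rightarrow> deque_state \<Rightarrow> bool" where
  push_left: "deque_step (out, d, x # inp) (out, x # d, inp)"
| push_right: "deque_step (out, d, x # inp) (out, d @ [x], inp)"
| pop_left: "deque_step (out, x # d, inp) (out @ [x], d, inp)"
| pop_right: "deque_step (out, d @ [x], inp) (out @ [x], d, inp)"

definition deque_sortable :: "nat list \<Rightarrow> bool" where
  "deque_sortable p \<longleftrightarrow>
     (\<exists>d inp. deque_step\<^sup>*\<^sup>* ([], [], p) ([1..<Suc (length p)], d, inp))"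


section \<open>Twinstacks and piles\<close>

text \<open>
  Stacks are lists with the top at the head; so is a pile. A twinstack is represented as a bare
  pair (left stack, right stack). That it is not empty on both sides, and that both stacks
  increase strictly from top to bottom, is not part of the type: these are properties of the
  piles that occur when the algorithm runs on a permutation.
\<close>

type_synonym twinstack = "nat list \<times> nat list"
type_synonym pile = "twinstack list"

fun twin_reverse :: "twinstack \<Rightarrow> twinstack" where
  "twin_reverse (L, R) = (R, L)"

fun weld :: "twinstack \<Rightarrow> twinstack \<Rightarrow> twinstack" where
  "weld (L1, R1) (L2, R2) = (L1 @ L2, R1 @ R2)"

text \<open>
  Reverse if necessary so that the larger top element is on the left; a one-sided twinstack is
  put on its left side.
\<close>

fun orient :: "twinstack \<Rightarrow> twinstack" where
  "orient (L, R) =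
     (if L = [] \<or> (R \<noteq> [] \<and> hd L < hd R) then twin_reverse (L, R) else (L, R))"

definition single_largest :: "nat list \<Rightarrow> nat list \<Rightarrow> bool" where
  "single_largest A B \<longleftrightarrow> (\<exists>m. A = [m] \<and> (\<forall>y\<in>set B. y < m))"

fun monotonic :: "twinstack \<Rightarrow> bool" where
  "monotonic (L, R) \<longleftrightarrow> L = [] \<or> R = [] \<or> single_largest L R \<or> single_largest R L"

text \<open>Meant for monotonic twinstacks.\<close>

fun make_one_sided :: "twinstack \<Rightarrow> twinstack" where
  "make_one_sided (L, R) =
     (if L = [] \<or> R = [] then (L, R)
      else if single_largest L R then ([], R @ L)
      else (L @ R, []))"


section \<open>The algorithm\<close>

text \<open>
  \<open>None\<close> means that the algorithm returns FALSE. On permutations, the left stacks of \<open>T\<close> and of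
  the twinstack below it are never empty here, so the value of \<open>hd []\<close> plays no role, and \<open>x\<close>
  differs from the top elements it is compared with, so that \<open>None\<close> is the case where \<open>x\<close> is
  larger than both of them.
\<close>

fun normalize :: "pile \<Rightarrow> pile option" where
  "normalize [] = Some []"
| "normalize [T] = Some [T]"
| "normalize (T # (L2, R2) # P) =
     (let x = hd (fst T) in
      if R2 \<noteq> [] then
        if x < hd L2 \<and> x < hd R2 then Some (T # (L2, R2) # P)
        else if x < hd L2 then Some (weld T (L2, R2) # P)
        else if x < hd R2 then Some (weld (twin_reverse T) (L2, R2) # P)
        else None
      else
        if x < hd L2 then Some (T # (L2, R2) # P)
        else if P = [] \<and> (\<forall>y \<in> set L2 \<union> set R2. y < x) then
          (let T' = (tl (fst T), snd T); B = (L2 @ [x], R2) in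
           Some [if T' = ([], []) then B else weld (twin_reverse T') B])
        else normalize (weld T (twin_reverse (L2, R2)) # P))"

text \<open>
  What happens to the top twinstack \<open>T\<close>, lying on \<open>P\<close>, after one of its elements was popped;
  \<open>from_right\<close> tells whether that element came from the right stack. The rearrangement of a
  monotonic bottom twinstack precedes the reversal, so that a one-sided twinstack always ends up
  on its left side.
\<close>

definition after_pop :: "bool \<Rightarrow> twinstack \<Rightarrow> pile \<Rightarrow> pile" where
  "after_pop from_right T P =
     (if T = ([], []) then P
      else orient (if from_right \<and> P = [] \<and> monotonic T then make_one_sided T else T) # P)"

text \<open>The number of elements in a pile, the termination measure for \<open>to_output\<close>.\<close>

definition pile_size :: "pile \<Rightarrow> nat" where
  "pile_size P = (\<Sum>(L, R)\<leftarrow>P. length L + length R)"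

lemma pile_size_after_pop:
  "pile_size (after_pop b (L, R) P) = length L + length R + pile_size P"
  by (auto simp: after_pop_def pile_size_def)

function (sequential) to_output :: "nat list \<Rightarrow> pile \<Rightarrow> nat list \<times> pile" where
  "to_output out [] = (out, [])"
| "to_output out ((L, R) # P) =
     (let c = 1 + length out in
      if R \<noteq> [] \<and> hd R = c then to_output (out @ [c]) (after_pop True (L, tl R) P)
      else if L \<noteq> [] \<and> hd L = c then to_output (out @ [c]) (after_pop False (tl L, R) P)
      else (out, (L, R) # P))"
  by pat_completeness auto
termination
  by (relation "measure (\<lambda>(out, P). pile_size P)")
     (auto simp: pile_size_after_pop, auto simp: pile_size_def neq_Nil_conv)

fun rtm_loop :: "nat list \<Rightarrow> pile \<Rightarrow> nat list \<Rightarrow> bool" where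
  "rtm_loop out P [] = True"
| "rtm_loop out P (x # inp) =
     (case normalize (([x], []) # P) of
        None \<Rightarrow> False
      | Some P' \<Rightarrow> (case to_output out P' of (out', P'') \<Rightarrow> rtm_loop out' P'' inp))"

definition rtm :: "nat list \<Rightarrow> bool" where
  "rtm p = rtm_loop [] [] p"

end

theory Submission
  imports Defs
begin

text \<open>
  Two facts about the deque itself drive the proof: in a sorting run no element is ever smaller than
  some element on its left and some element on its right (a valley), and an element that the output
  needs next may be popped at once. A pile stands for the set of all deques that arise by choosing an
  orientation for each of its twinstacks. The elements of a pile increase from one twinstack to the
  one below it, so none of these deques has a valley, and the pile kept by the algorithm represents
  exactly the valley-free deques reachable by popping as early as possible: welding and failing
  discard precisely the deques in which the new element creates a valley. An element larger than both
  top elements of the bottom twinstack fits only if this twinstack is monotonic, which the algorithm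
  recognizes because it keeps a monotonic bottom twinstack one-sided.
\<close>

section \<open>Runs of the deque\<close>

definition valley :: "nat list \<Rightarrow> bool" where
  "valley d \<longleftrightarrow> (\<exists>A v B. d = A @ v # B \<and> (\<exists>u\<in>set A. v < u) \<and> (\<exists>w\<in>set B. v < w))"

text \<open>\<open>deque_sortable\<close> leaves the final deque and input open. Here they are
  empty, which amounts to the same for a full output, since steps preserve the multiset of all
  elements.\<close>

definition completes :: "nat list \<Rightarrow> deque_state \<Rightarrow> bool" where
  "completes F s \<longleftrightarrow> deque_step\<^sup>*\<^sup>* s (F, [], [])"

lemma valleyI: "d = A @ v # B \<Longrightarrow> u \<in> set A \<Longrightarrow> v < u \<Longrightarrow> w \<in> set B \<Longrightarrow> v < w \<Longrightarrow> valley d"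
  unfolding valley_def by blast

lemma valley_rev [simp]: "valley (rev d) \<longleftrightarrow> valley d"
proof -
  have "valley (rev d)" if "valley d" for d
  proof -
    from that obtain A v B u w where
      "d = A @ v # B" "u \<in> set A" "v < u" "w \<in> set B" "v < w"
      unfolding valley_def by blast
    then show ?thesis
      by (intro valleyI[where A = "rev B" and v = v and B = "rev A" and u = w and w = u]) auto
  qed
  from this[of d] this[of "rev d"] show ?thesis by auto
qed

lemma valley_Cons: "valley d \<Longrightarrow> valley (x # d)"
  unfolding valley_def by (metis append_Cons list.set_intros(2))

lemma valley_snoc: "valley d \<Longrightarrow> valley (d @ [x])"
  using valley_Cons[of "rev d" x] valley_rev[of "d @ [x]"] by simp

section \<open>What runs preserve: the elements and the output prefix\<close>

lemma deque_step_mset: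
  assumes "deque_step s t"
  shows "mset (fst s @ fst (snd s) @ snd (snd s)) = mset (fst t @ fst (snd t) @ snd (snd t))"
  using assms by (induction rule: deque_step.induct) auto

lemma deque_steps_mset:
  assumes "deque_step\<^sup>*\<^sup>* s t"
  shows "mset (fst s @ fst (snd s) @ snd (snd s)) = mset (fst t @ fst (snd t) @ snd (snd t))"
  using assms by (induction rule: rtranclp_induct) (auto dest: deque_step_mset)

lemma deque_steps_output:
  assumes "deque_step\<^sup>*\<^sup>* s t"
  shows "\<exists>rest. fst t = fst s @ rest"
  using assms
proof (induction rule: rtranclp_induct)
  case (step y z)
  from step.hyps(2) have "\<exists>rest. fst z = fst y @ rest"
    by (induction rule: deque_step.induct) auto
  with step.IH show ?case by auto
qed simp

lemma completes_output:
  assumes "completes F (out, d, inp)"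
  obtains rest where "F = out @ rest" "mset rest = mset d + mset inp"
  using deque_steps_output[OF assms[unfolded completes_def]]
    deque_steps_mset[OF assms[unfolded completes_def]] by auto

text \<open>For undoing pops: if \<open>x\<close> lies below everything in \<open>d\<close>, the
  second case is impossible, so putting \<open>x\<close> back creates no valley.\<close>

lemma valley_ConsE:
  assumes "valley (x # d)"
  obtains "valley d" | v where "v \<in> set d" "v < x"
proof -
  from assms obtain A v B u w where *: "x # d = A @ v # B"
    "u \<in> set A" "v < u" "w \<in> set B" "v < w"
    unfolding valley_def by blast
  then obtain A' where A: "A = x # A'" by (cases A) auto
  with * have d: "d = A' @ v # B" by simp
  show thesis
  proof (cases "u = x")
    case True
    with * d that(2) show ?thesis by auto
  next
    case False
    with A * d that(1) show ?thesis by (auto intro: valleyI)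
  qed
qed

text \<open>What is left in the deque must still be output, so it follows \<open>x\<close> in the
  increasing \<open>F\<close>.\<close>

lemma completes_pop_less:
  assumes "completes F (out @ [x], d, inp)" "sorted_wrt (<) F" "v \<in> set d"
  shows "x < v"
proof -
  obtain rest where F: "F = (out @ [x]) @ rest" and "mset rest = mset d + mset inp"
    using completes_output[OF assms(1)] .
  then have "v \<in> set rest" using assms(3) by (metis set_mset_mset set_mset_union UnI1)
  with F assms(2) show ?thesis by (simp add: sorted_wrt_append)
qed

text \<open>Read the run backwards from the final empty deque: undoing a push only shortens the
  deque, and undoing a pop adds an end element smaller than all others.\<close>

lemma completes_no_valley:
  assumes "completes F (out, d, inp)" "sorted_wrt (<) F"
  shows "\<not> valley d"
proof -
  have "\<not> valley (fst (snd s))" if "deque_step\<^sup>*\<^sup>* s (F, [], [])" for s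
    using that
  proof (induction rule: converse_rtranclp_induct)
    case base
    show ?case by (simp add: valley_def)
  next
    case (step s t)
    have t: "completes F t" using step.hyps(2) by (simp add: completes_def)
    from step.hyps(1) t step.IH show ?case
    proof (induction rule: deque_step.induct)
      case (pop_left out x d inp)
      show ?case
      proof
        assume "valley (fst (snd (out, x # d, inp)))"
        then have "valley (x # d)" by simp
        then show False
          using pop_left completes_pop_less[OF pop_left(1) assms(2)]
          by (elim valley_ConsE) fastforce+
      qed
    next
      case (pop_right out d x inp)
      show ?case
      proof
        assume "valley (fst (snd (out, d @ [x], inp)))"
        then have "valley (x # rev d)" using valley_rev[of "d @ [x]"] by simp
        then show False
          using pop_right completes_pop_less[OF pop_right(1) assms(2)]
          by (elim valley_ConsE) fastforce+
      qed
    qed (auto dest: valley_Cons valley_snoc)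
  qed
  from this[of "(out, d, inp)"] assms(1) show ?thesis by (simp add: completes_def)
qed

text \<open>In a successful run an available next output element may be output at once: the moves that
  precede its pop are pushes, which do not depend on its presence.\<close>

lemma completes_pop_first:
  assumes "completes F (out, d, inp)" "F = out @ c # rest" "c \<in> set d" "distinct F"
  shows "completes F (out @ [c], remove1 c d, inp)"
proof -
  have "completes F (fst s @ [c], remove1 c (fst (snd s)), snd (snd s))"
    if "deque_step\<^sup>*\<^sup>* s (F, [], [])" "F = fst s @ c # rest" "c \<in> set (fst (snd s))" for s
    using that
  proof (induction rule: converse_rtranclp_induct)
    case base
    then show ?case by simp
  next
    case (step s t)
    have t: "completes F t" using step.hyps(2) by (simp add: completes_def)
    from step.hyps(1) t step.IH step.prems show ?case
    proof (induction rule: deque_step.induct)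
      case (push_left out d x inp)
      obtain r where r: "F = out @ r" "mset r = mset (x # d) + mset inp"
        using completes_output[OF push_left(1)] .
      \<comment> \<open>\<open>c\<close> is already in \<open>d\<close>, so a pushed
        \<open>x = c\<close> would occur twice in \<open>F\<close>. Hence \<open>remove1 c\<close>
        skips the new head.\<close>
      have "distinct r" using r(1) assms(4) by simp
      then have "x \<noteq> c" using r(2) push_left(4)
        by (metis distinct_append distinct.simps(2) Un_iff fst_conv mset_append mset_eq_imp_distinct_iff
              set_append snd_conv append_Cons)
      then have "completes F (out @ [c], x # remove1 c d, inp)" using push_left by simp
      then show ?case unfolding completes_def
        by (auto intro: converse_rtranclp_into_rtranclp deque_step.push_left)
    next
      case (push_right out d x inp)
      then have "completes F (out @ [c], remove1 c d @ [x], inp)"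
        by (simp add: remove1_append)
      then show ?case unfolding completes_def
        by (auto intro: converse_rtranclp_into_rtranclp deque_step.push_right)
    next
      case (pop_left out x d inp)
      \<comment> \<open>\<open>F\<close> demands \<open>c\<close> right after \<open>out\<close>, so
        a first pop must be that of \<open>c\<close> itself.\<close>
      obtain r where "F = (out @ [x]) @ r" using completes_output[OF pop_left(1)] .
      with pop_left(3) have "x = c" by simp
      with pop_left(1) show ?case by simp
    next
      case (pop_right out d x inp)
      obtain r where r: "F = (out @ [x]) @ r" "mset r = mset d + mset inp"
        using completes_output[OF pop_right(1)] .
      with pop_right(3) have x: "x = c" by simp
      \<comment> \<open>\<open>remove1\<close> deletes the leftmost occurrence, so it hits the right
        end only if \<open>d\<close> is free of \<open>c\<close>.\<close>
      have "x \<notin> set r" using r(1) assms(4) by simp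
      then have "c \<notin> set d" using r(2) x
        by (metis UnI1 set_mset_mset set_mset_union)
      with x pop_right(1) show ?case by (simp add: remove1_append)
    qed
  qed
  from this[of "(out, d, inp)"] assms show ?thesis by (simp add: completes_def)
qed

text \<open>With the next output \<open>c\<close> absent from the deque, any pop would spoil the
  output, so the run must begin with a push.\<close>

lemma completes_push:
  assumes "completes F (out, d, x # inp)" "F = out @ c # rest" "c \<notin> set d"
  shows "completes F (out, x # d, inp) \<or> completes F (out, d @ [x], inp)"
proof -
  from assms(1) obtain t where t: "deque_step (out, d, x # inp) t" "completes F t"
    unfolding completes_def by (cases rule: converse_rtranclpE) auto
  from t(1) show ?thesis
  proof (cases rule: deque_step.cases)
    case (pop_left y d')
    then have "completes F (out @ [y], d', x # inp)" using t(2) by simp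
    then obtain r where "F = (out @ [y]) @ r" by (rule completes_output)
    with assms(2,3) pop_left show ?thesis by simp
  next
    case (pop_right d' y)
    then have "completes F (out @ [y], d', x # inp)" using t(2) by simp
    then obtain r where "F = (out @ [y]) @ r" by (rule completes_output)
    with assms(2,3) pop_right show ?thesis by simp
  qed (use t(2) in auto)
qed

text \<open>Popping greedily loses nothing by \<open>completes_pop_first\<close>. It gains nothing
  either: the minimum of a valley-free deque sits at an end, so its pop is a legal step.\<close>

lemma completes_pop_iff:
  assumes "\<not> valley d" "distinct d" "c \<in> set d" "\<forall>y\<in>set d. c \<le> y"
    "F = out @ c # rest" "distinct F"
  shows "completes F (out, d, inp) \<longleftrightarrow> completes F (out @ [c], remove1 c d, inp)"
proof
  assume "completes F (out, d, inp)"
  then show "completes F (out @ [c], remove1 c d, inp)"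
    using assms completes_pop_first by blast
next
  assume *: "completes F (out @ [c], remove1 c d, inp)"
  obtain A B where d: "d = A @ c # B" using assms(3) by (meson split_list)
  have "A = [] \<or> B = []"
  proof (rule ccontr)
    assume "\<not> (A = [] \<or> B = [])"
    then obtain u w where uw: "u \<in> set A" "w \<in> set B" by (meson list.set_sel(1))
    with d assms(2,4) have "c < u" "c < w" by (auto simp: order_less_le)
    with d uw have "valley d" by (auto intro: valleyI)
    with assms(1) show False ..
  qed
  then have "deque_step (out, d, inp) (out @ [c], remove1 c d, inp)"
    using d assms(2) by (auto simp: remove1_append intro: deque_step.intros)
  then show "completes F (out, d, inp)"
    using * unfolding completes_def by (rule converse_rtranclp_into_rtranclp)
qed

section \<open>The deques represented by a pile\<close>

text \<open>Each twinstack may be reversed independently; the left end of the deque is its head.\<close>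

fun arrangements :: "pile \<Rightarrow> nat list set" where
  "arrangements [] = {[]}"
| "arrangements ((L, R) # P) = (\<Union>d\<in>arrangements P. {L @ d @ rev R, R @ d @ rev L})"

definition twin_set :: "twinstack \<Rightarrow> nat set" where
  "twin_set T = set (fst T) \<union> set (snd T)"

definition pile_set :: "pile \<Rightarrow> nat set" where
  "pile_set P = (\<Union>T\<in>set P. twin_set T)"

text \<open>The normal form produced by \<open>orient\<close>: a one-sided twinstack lies on the
  left, otherwise the larger top does.\<close>

fun twin_ok :: "twinstack \<Rightarrow> bool" where
  "twin_ok (L, R) \<longleftrightarrow> L \<noteq> [] \<and> sorted_wrt (<) L \<and> sorted_wrt (<) R \<and> set L \<inter> set R = {} \<and>
     (R \<noteq> [] \<longrightarrow> hd R < hd L)"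

text \<open>The deque of a monotonic bottom twinstack still accepts a new maximum at the end where its
  largest element is, which the algorithm recognizes on one-sided twinstacks only.\<close>

fun pile_ok :: "pile \<Rightarrow> bool" where
  "pile_ok [] \<longleftrightarrow> True"
| "pile_ok (T # P) \<longleftrightarrow> twin_ok T \<and> (\<forall>a\<in>twin_set T. \<forall>b\<in>pile_set P. a < b) \<and>
     (P = [] \<and> monotonic T \<longrightarrow> snd T = []) \<and> pile_ok P"

section \<open>Arrangements: their elements and the absence of valleys\<close>

lemma pile_set_simps [simp]:
  "pile_set [] = {}" "pile_set (T # P) = twin_set T \<union> pile_set P"
  by (auto simp: pile_set_def)

lemma twin_set_Pair [simp]: "twin_set (L, R) = set L \<union> set R"
  by (simp add: twin_set_def)

lemma set_arrangements: "d \<in> arrangements P \<Longrightarrow> set d = pile_set P"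
  by (induction P arbitrary: d rule: arrangements.induct) auto

lemma sorted_wrt_less_distinct: "sorted_wrt (<) (L :: nat list) \<Longrightarrow> distinct L"
  by (simp add: strict_sorted_iff)

lemma sorted_hd_le: "sorted_wrt (<) (L :: nat list) \<Longrightarrow> y \<in> set L \<Longrightarrow> hd L \<le> y"
  by (cases L) auto

lemma distinct_arrangements: "pile_ok P \<Longrightarrow> d \<in> arrangements P \<Longrightarrow> distinct d"
proof (induction P arbitrary: d rule: arrangements.induct)
  case (2 L R P)
  then obtain e where e: "e \<in> arrangements P" "d = L @ e @ rev R \<or> d = R @ e @ rev L" by auto
  have "distinct e" "set e = pile_set P" using 2 e set_arrangements by auto
  moreover have "distinct L" "distinct R" "set L \<inter> set R = {}"
    "set L \<inter> pile_set P = {}" "set R \<inter> pile_set P = {}"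
    using 2(2) sorted_wrt_less_distinct by auto
  ultimately show ?case using e(2) by auto
qed simp

text \<open>Locates \<open>v\<close> in one of two segments; applied twice, it places a supposed
  valley in \<open>L\<close>, \<open>d\<close> or \<open>rev R\<close>.\<close>

lemma append_eq_append_ConsE:
  assumes "L @ Y = A @ v # B"
  obtains (left) C where "L = A @ v # C" "B = C @ Y" | (right) C where "A = L @ C" "Y = C @ v # B"
proof -
  from assms consider us where "L = A @ us" "us @ Y = v # B" | us where "A = L @ us" "Y = us @ v # B"
    by (auto simp: append_eq_append_conv2)
  then show thesis
  proof cases
    case (1 us)
    \<comment> \<open>If \<open>us\<close> is empty, \<open>v\<close> is the head of
      \<open>Y\<close>, which is the right case with \<open>C = []\<close>.\<close>
    with left right[of "[]"] show thesis by (cases us) auto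
  qed (use right in auto)
qed

text \<open>In the increasing \<open>L\<close> nothing on the left is larger, in the decreasing
  \<open>rev R\<close> nothing on the right is. For a valley inside \<open>d\<close>, the smaller
  elements of \<open>L\<close> and \<open>R\<close> cannot serve as witnesses.\<close>

lemma no_valley_append:
  assumes "sorted_wrt (<) L" "sorted_wrt (<) R" "\<not> valley d"
    "\<forall>a\<in>set L \<union> set R. \<forall>b\<in>set d. a < b"
  shows "\<not> valley (L @ d @ rev R)"
proof
  assume "valley (L @ d @ rev R)"
  then obtain A v B u w where *: "L @ (d @ rev R) = A @ v # B"
    "u \<in> set A" "v < u" "w \<in> set B" "v < w"
    unfolding valley_def by blast
  from *(1) show False
  proof (cases rule: append_eq_append_ConsE)
    case left
    with * assms(1) show False by (auto simp: sorted_wrt_append)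
  next
    case (right C)
    note A = right(1)
    from right(2) show False
    proof (cases rule: append_eq_append_ConsE)
      case (left D)
      then have "v \<in> set d" by simp
      then have "u \<notin> set L" "w \<notin> set R" using * assms(4) by (meson UnCI order_less_asym)+
      then have "u \<in> set C" "w \<in> set D" using * A left(2) by auto
      with left(1) *(3,5) assms(3) show False using valleyI by blast
    next
      case (right D)
      then have "rev (rev R) = rev (D @ v # B)" by simp
      then have "R = rev B @ v # rev D" by simp
      with * assms(2) show False by (auto simp: sorted_wrt_append)
    qed
  qed
qed

lemma arrangements_no_valley: "pile_ok P \<Longrightarrow> d \<in> arrangements P \<Longrightarrow> \<not> valley d"
proof (induction P arbitrary: d rule: arrangements.induct)
  case 1
  then show ?case by (simp add: valley_def)
next
  case (2 L R P)
  then obtain e where e: "e \<in> arrangements P" "d = L @ e @ rev R \<or> d = R @ e @ rev L" by auto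
  moreover have "\<not> valley e" "set e = pile_set P" using 2 e set_arrangements by auto
  ultimately show ?case using 2(2) no_valley_append[of L R e] no_valley_append[of R L e] by auto
qed

section \<open>The normalization step\<close>

lemma valley_Cons_larger:
  assumes "\<not> valley (x # y # Y)" "y < x" "w \<in> set Y"
  shows "w \<le> y"
  using assms valleyI[of "x # y # Y" "[x]" y Y x w] by fastforce

lemma sorted_singleton_if_hd_max:
  assumes "sorted_wrt (<) (y # Y)" "\<forall>w\<in>set Y. w \<le> (y::nat)"
  shows "Y = []"
  using assms by (cases Y) auto

text \<open>The top \<open>hd L\<close> next to the larger \<open>x\<close> must bound everything
  beyond it. But the rest of \<open>L\<close> and all of \<open>d\<close> exceed it, so both are
  empty.\<close>

lemma no_valley_above_top:
  assumes "\<not> valley (x # L @ d @ Z)" "L \<noteq> []" "hd L < x" "sorted_wrt (<) L"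
    "\<forall>a\<in>set L. \<forall>b\<in>set d. a < b"
  shows "\<exists>l. L = [l] \<and> d = [] \<and> (\<forall>z\<in>set Z. z \<le> l)"
proof -
  obtain l L' where L: "L = l # L'" using assms(2) by (cases L) auto
  have le: "w \<le> l" if "w \<in> set (L' @ d @ Z)" for w
    using valley_Cons_larger[of x l "L' @ d @ Z" w] assms(1,3) L that by simp
  have "L' = []" using sorted_singleton_if_hd_max[of l L'] assms(4) L le by auto
  moreover have "d = []" using le assms(5) L by (cases d) fastforce+
  ultimately show ?thesis using L le by auto
qed

text \<open>Reversing the deque amounts to reversing every twinstack.\<close>

lemma arrangements_rev: "d \<in> arrangements P \<Longrightarrow> rev d \<in> arrangements P"
  by (induction P arbitrary: d rule: arrangements.induct) fastforce+

text \<open>Since the set of arrangements is closed under reversal, it suffices to look at those that begin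
  with \<open>x\<close>.\<close>

lemma arrangements_top_cases:
  assumes "d \<in> arrangements (([x], R1) # P)" "\<not> valley d"
  obtains e where "e \<in> arrangements P" "\<not> valley (x # e @ rev R1)"
    "d = x # e @ rev R1 \<or> d = rev (x # e @ rev R1)"
proof -
  from assms(1) obtain f where f: "f \<in> arrangements P" "d = x # f @ rev R1 \<or> d = R1 @ f @ [x]"
    by auto
  from f(2) show thesis
  proof
    assume "d = x # f @ rev R1"
    with f(1) assms(2) that show thesis by blast
  next
    assume d: "d = R1 @ f @ [x]"
    then have r: "rev d = x # rev f @ rev R1" by simp
    then have "\<not> valley (x # rev f @ rev R1)" using assms(2) by (metis valley_rev)
    moreover have "d = rev (x # rev f @ rev R1)" using d by simp
    ultimately show thesis using that arrangements_rev[OF f(1)] by blast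
  qed
qed

definition valley_free :: "nat list set" where "valley_free = {d. \<not> valley d}"

lemma pile_ok_Int_valley_free [simp]: "pile_ok P \<Longrightarrow> arrangements P \<inter> valley_free = arrangements P"
  using arrangements_no_valley by (auto simp: valley_free_def)

text \<open>The right stack \<open>R1\<close> collects the one-sided twinstacks onto which \<open>x\<close> was welded so far. Its
  elements need not be smaller than \<open>x\<close>.\<close>

lemma normalize_spec:
  assumes "pile_ok P" "twin_ok ([x], R1)" "\<forall>a\<in>set R1. \<forall>b\<in>pile_set P. a < b" "x \<notin> pile_set P"
    "P = [] \<and> monotonic ([x], R1) \<longrightarrow> R1 = []"
  shows "case normalize (([x], R1) # P) of
      None \<Rightarrow> arrangements (([x], R1) # P) \<inter> valley_free = {}
    | Some Q \<Rightarrow> pile_ok Q \<and> pile_set Q = insert x (set R1 \<union> pile_set P) \<and>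
        arrangements Q = arrangements (([x], R1) # P) \<inter> valley_free"
  using assms
proof (induction P arbitrary: R1)
  case Nil
  then have "pile_ok [([x], R1)]" by simp
  then show ?case by (simp del: arrangements.simps pile_ok.simps)
next
  case (Cons T2 P)
  obtain L2 R2 where T2 [simp]: "T2 = (L2, R2)" by (cases T2)
  note prems = Cons.prems
  have tw2: "twin_ok (L2, R2)" and tw1: "twin_ok ([x], R1)" and okP: "pile_ok P"
    using prems by simp_all
  have ok2: "L2 \<noteq> []" "sorted_wrt (<) L2" "sorted_wrt (<) R2" "set L2 \<inter> set R2 = {}"
    "R2 \<noteq> [] \<Longrightarrow> hd R2 < hd L2" using tw2 by simp_all
  have okR1: "sorted_wrt (<) R1" "R1 \<noteq> [] \<Longrightarrow> hd R1 < x" "x \<notin> set R1"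
    using tw1 by simp_all
  have blk: "a < b" if "a \<in> set L2 \<union> set R2" "b \<in> pile_set P" for a b
    using prems(1) that by simp
  have bR1: "a < b" if "a \<in> set R1" "b \<in> set L2 \<union> set R2 \<union> pile_set P" for a b
    using prems(3) that by simp
  have mono: "R2 = []" if "P = []" "monotonic (L2, R2)"
    using prems(1) that by (simp del: monotonic.simps)
  have x: "x \<notin> set L2" "x \<notin> set R2" "x \<notin> pile_set P"
    using prems(4) by simp_all
  have disj: "set L2 \<inter> set R1 = {}" "set R2 \<inter> set R1 = {}"
    using bR1 by fastforce+
  have hdL2: "hd L2 \<in> set L2" using ok2 by simp
  have xL2: "x \<noteq> hd L2" using x hdL2 by auto
  \<comment> \<open>Tops are minima of their stacks and lower twinstacks are larger, so
    \<open>x\<close> lies below the whole pile. The unchanged pile is then ok and the valley filter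
    removes nothing.\<close>
  have settled: ?case if "normalize (([x], R1) # T2 # P) = Some (([x], R1) # T2 # P)"
    "x < hd L2" "R2 \<noteq> [] \<Longrightarrow> x < hd R2"
  proof -
    have "x < a" if "a \<in> set L2 \<union> set R2" for a
      using that \<open>x < hd L2\<close> \<open>R2 \<noteq> [] \<Longrightarrow> x < hd R2\<close> sorted_hd_le[OF ok2(2), of a] sorted_hd_le[OF ok2(3), of a]
      by fastforce
    moreover have "x < b" if "b \<in> pile_set P" for b
      using that \<open>x < hd L2\<close> blk[of "hd L2" b] hdL2 by auto
    ultimately have "pile_ok (([x], R1) # T2 # P)" using prems by auto
    then show ?thesis using that(1) by (simp del: arrangements.simps pile_ok.simps)
  qed
  show ?case
  proof (cases "R2 = []")
    case False
    have hdR2: "hd R2 \<in> set R2" using False by simp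
    \<comment> \<open>Since the left top is the larger one, a weld in the middle case happens
      without reversing \<open>T\<close>.\<close>
    consider "x < hd R2" | "hd R2 < x" "x < hd L2" | "hd L2 < x" "hd R2 < x"
      using xL2 x hdR2 ok2(5)[OF False] by (metis linorder_neqE_nat)
    then show ?thesis
    proof cases
      case 1
      then show ?thesis using False ok2(5) by (intro settled) auto
    next
      case 2
      let ?Q = "(x # L2, R1 @ R2) # P"
      have n: "normalize (([x], R1) # T2 # P) = Some ?Q" using 2 False by simp
      have "\<forall>y\<in>set L2. x < y" using 2 sorted_hd_le[OF ok2(2)] by fastforce
      moreover have "x < b" if "b \<in> pile_set P" for b
        using that 2 blk[of "hd L2" b] hdL2 by auto
      moreover have "hd (R1 @ R2) < x" using 2 okR1 by (cases R1) auto
      \<comment> \<open>The left stack has at least two elements; a right stack with a single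
        element would be \<open>[hd R2]\<close>, which is below \<open>x\<close>.\<close>
      moreover have "\<not> monotonic (x # L2, R1 @ R2)"
        using False ok2(1) 2 by (auto simp: single_largest_def append_eq_Cons_conv)
      ultimately have ok: "pile_ok ?Q"
        using ok2 okP okR1 x blk bR1 disj by (auto simp: sorted_wrt_append)
      have "d \<in> arrangements ?Q" if d: "d \<in> arrangements (([x], R1) # T2 # P)" "\<not> valley d" for d
      proof -
        obtain e where e: "e \<in> arrangements (T2 # P)" and nv: "\<not> valley (x # e @ rev R1)"
          and de: "d = x # e @ rev R1 \<or> d = rev (x # e @ rev R1)"
          using arrangements_top_cases[OF d] .
        from e obtain f where f: "f \<in> arrangements P" "e = L2 @ f @ rev R2 \<or> e = R2 @ f @ rev L2"
          by auto
        \<comment> \<open>In this orientation \<open>hd R2\<close> would be a valley between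
          \<open>x\<close> and \<open>hd L2\<close>.\<close>
        have "e \<noteq> R2 @ f @ rev L2"
        proof
          assume "e = R2 @ f @ rev L2"
          then have "valley (x # e @ rev R1)" using 2 ok2(5)[OF False] hdL2 False
            by (intro valleyI[of _ "[x]" "hd R2" "tl R2 @ f @ rev L2 @ rev R1" x "hd L2"]) auto
          with nv show False ..
        qed
        then have "x # e @ rev R1 \<in> arrangements ?Q" using f by auto
        with de arrangements_rev show ?thesis by blast
      qed
      moreover have "arrangements ?Q \<subseteq> arrangements (([x], R1) # T2 # P)" by auto
      ultimately have "arrangements ?Q = arrangements (([x], R1) # T2 # P) \<inter> valley_free"
        using arrangements_no_valley[OF ok] unfolding valley_free_def by blast
      moreover have "pile_set ?Q = insert x (set R1 \<union> pile_set (T2 # P))" by auto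
      ultimately show ?thesis unfolding n option.case using ok by blast
    next
      case 3
      have n: "normalize (([x], R1) # T2 # P) = None" using 3 False by simp
      \<comment> \<open>Whichever stack is next to \<open>x\<close> would have to be a single
        largest element with nothing deeper. Then \<open>T2\<close> would be a monotonic bottom
        twinstack with two sides, which \<open>pile_ok\<close> excludes.\<close>
      have "valley d" if d: "d \<in> arrangements (([x], R1) # T2 # P)" for d
      proof (rule ccontr)
        assume "\<not> valley d"
        obtain e where e: "e \<in> arrangements (T2 # P)" and nv: "\<not> valley (x # e @ rev R1)"
          using arrangements_top_cases[OF d \<open>\<not> valley d\<close>] by blast
        from e obtain f where f: "f \<in> arrangements P" "e = L2 @ f @ rev R2 \<or> e = R2 @ f @ rev L2"
          by auto
        have sf: "set f = pile_set P" using f(1) set_arrangements by simp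
        have "P = []" if "f = []" using that sf prems(1)
          by (cases P) (auto elim!: twin_ok.elims)
        from f(2) show False
        proof
          assume "e = L2 @ f @ rev R2"
          then obtain l where l: "L2 = [l]" "f = []" "\<forall>z\<in>set R2. z \<le> l"
            using no_valley_above_top[of x L2 f "rev R2 @ rev R1"] nv ok2 3 blk sf by auto
          then have "single_largest L2 R2" using ok2(4)
            by (auto simp: single_largest_def order_less_le)
          then show False using mono False l(2) \<open>f = [] \<Longrightarrow> P = []\<close> by simp
        next
          assume "e = R2 @ f @ rev L2"
          then obtain l where l: "R2 = [l]" "f = []" "\<forall>z\<in>set L2. z \<le> l"
            using no_valley_above_top[of x R2 f "rev L2 @ rev R1"] nv ok2 3 blk sf False by auto
          then have "single_largest R2 L2" using ok2(4)
            by (auto simp: single_largest_def order_less_le)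
          then show False using mono False l(2) \<open>f = [] \<Longrightarrow> P = []\<close> by simp
        qed
      qed
      then show ?thesis unfolding n option.case valley_free_def by blast
    qed
  next
    case R2: True
    show ?thesis
    proof (cases "x < hd L2")
      case True
      with R2 show ?thesis by (intro settled) auto
    next
      case False
      then have gt: "hd L2 < x" using xL2 by simp
      \<comment> \<open>Welding onto the reversed \<open>T2\<close> puts \<open>L2\<close> at the
        end away from \<open>x\<close>. The other orientation avoids a valley only if
        \<open>L2\<close> is a singleton and \<open>f\<close> is empty, and then both orientations
        coincide.\<close>
      have eq: "arrangements (([x], R1) # T2 # P) \<inter> valley_free =
        arrangements (([x], R1 @ L2) # P) \<inter> valley_free"
      proof (intro equalityI subsetI IntI)
        fix d assume "d \<in> arrangements (([x], R1) # T2 # P) \<inter> valley_free"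
        then have d: "d \<in> arrangements (([x], R1) # T2 # P)" "\<not> valley d"
          by (auto simp: valley_free_def)
        obtain e where e: "e \<in> arrangements (T2 # P)" and nv: "\<not> valley (x # e @ rev R1)"
          and de: "d = x # e @ rev R1 \<or> d = rev (x # e @ rev R1)"
          using arrangements_top_cases[OF d] .
        from e R2 obtain f where f: "f \<in> arrangements P" "e = L2 @ f \<or> e = f @ rev L2"
          by auto
        have sf: "set f = pile_set P" using f(1) set_arrangements by simp
        have "e = f @ rev L2" if "e = L2 @ f"
          using no_valley_above_top[of x L2 f "rev R1"] nv ok2 gt blk sf that by auto
        with f have "x # e @ rev R1 \<in> arrangements (([x], R1 @ L2) # P)" by auto
        with de arrangements_rev show "d \<in> arrangements (([x], R1 @ L2) # P)" by blast
      qed (use R2 in auto)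
      show ?thesis
      proof (cases "P = [] \<and> (\<forall>y\<in>set L2. y < x)")
        case True
        have n: "normalize (([x], R1) # T2 # P) = Some [(R1 @ L2 @ [x], [])]"
          using R2 False True by (auto simp: Let_def)
        have "\<forall>a\<in>set R1. a < x" using True bR1 hdL2 by fastforce
        then have ok: "pile_ok [(R1 @ L2 @ [x], [])]"
          using True ok2 okR1 bR1 by (auto simp: sorted_wrt_append)
        \<comment> \<open>With nothing below, \<open>x\<close> at the bottom of one stack and
          \<open>x\<close> alone on the opposite stack give the same two deques.\<close>
        have "arrangements [(R1 @ L2 @ [x], [])] = arrangements (([x], R1 @ L2) # P)"
          using True by auto
        then have "arrangements [(R1 @ L2 @ [x], [])] = arrangements (([x], R1) # T2 # P) \<inter> valley_free"
          unfolding eq using pile_ok_Int_valley_free[OF ok] by simp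
        moreover have "pile_set [(R1 @ L2 @ [x], [])] = insert x (set R1 \<union> pile_set (T2 # P))"
          using True R2 by auto
        ultimately show ?thesis unfolding n option.case using ok by blast
      next
        case nsp: False
        have n: "normalize (([x], R1) # T2 # P) = normalize (([x], R1 @ L2) # P)"
          using R2 False nsp by (auto simp: Let_def)
        have "hd (R1 @ L2) < x" using okR1 gt by (cases R1) auto
        then have "twin_ok ([x], R1 @ L2)"
          using ok2 okR1 bR1 x by (auto simp: sorted_wrt_append)
        \<comment> \<open>Some element of \<open>L2\<close> exceeds \<open>x\<close>, so
          \<open>x\<close> is not the largest; a singleton \<open>R1 @ L2\<close> would be
          \<open>[hd L2]\<close>, which is below \<open>x\<close>.\<close>
        moreover have "\<not> monotonic ([x], R1 @ L2)" if "P = []"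
          using that nsp gt ok2(1) by (auto simp: single_largest_def append_eq_Cons_conv)
        ultimately have "case normalize (([x], R1 @ L2) # P) of
            None \<Rightarrow> arrangements (([x], R1 @ L2) # P) \<inter> valley_free = {}
          | Some Q \<Rightarrow> pile_ok Q \<and> pile_set Q = insert x (set (R1 @ L2) \<union> pile_set P) \<and>
              arrangements Q = arrangements (([x], R1 @ L2) # P) \<inter> valley_free"
          using Cons.IH[of "R1 @ L2"] okP blk bR1 x by auto
        moreover have "set (R1 @ L2) \<union> pile_set P = set R1 \<union> pile_set (T2 # P)" using R2 by auto
        ultimately show ?thesis unfolding n eq by metis
      qed
    qed
  qed
qed

section \<open>The output step\<close>

lemma arrangements_reverse: "arrangements ((R, L) # P) = arrangements ((L, R) # P)"
  by auto

lemma arrangements_orient: "arrangements (orient T # P) = arrangements (T # P)"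
  by (cases T) (auto simp: arrangements_reverse)

text \<open>In a bottom twinstack the two stack bottoms are adjacent in the deque, so a singleton
  stack may equally be the bottom of the other one.\<close>

lemma arrangements_make_one_sided:
  "monotonic T \<Longrightarrow> arrangements [make_one_sided T] = arrangements [T]"
  by (cases T) (auto simp: single_largest_def)

lemma arrangements_after_pop: "arrangements (after_pop b T P) = arrangements (T # P)"
  by (auto simp: after_pop_def arrangements_orient arrangements_make_one_sided)

lemma twin_set_orient [simp]: "twin_set (orient T) = twin_set T"
  by (cases T) auto

lemma twin_set_make_one_sided [simp]: "twin_set (make_one_sided T) = twin_set T"
  by (cases T) auto

lemma pile_set_after_pop: "pile_set (after_pop b T P) = twin_set T \<union> pile_set P"
  by (auto simp: after_pop_def)

lemma twin_ok_orient:
  assumes "(L, R) \<noteq> ([], [])" "sorted_wrt (<) L" "sorted_wrt (<) R" "set L \<inter> set R = {}"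
  shows "twin_ok (orient (L, R))"
proof -
  have "hd L \<noteq> hd R" if "L \<noteq> []" "R \<noteq> []"
    using assms(4) that by (metis IntI empty_iff hd_in_set)
  then show ?thesis using assms by auto
qed

lemma monotonic_orient [simp]: "monotonic (orient (L, R)) \<longleftrightarrow> monotonic (L, R)"
  by auto

lemma snd_orient: "L = [] \<or> R = [] \<Longrightarrow> snd (orient (L, R)) = []"
  by auto

lemma make_one_sided_sorted:
  assumes "monotonic (L, R)" "sorted_wrt (<) L" "sorted_wrt (<) R" "make_one_sided (L, R) = (L', R')"
  shows "sorted_wrt (<) L'" "sorted_wrt (<) R'" "L' = [] \<or> R' = []"
  using assms by (auto simp: single_largest_def sorted_wrt_append split: if_splits)

text \<open>Only a right pop triggers the rearrangement. After a left pop, \<open>R = []\<close>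
  already makes the twinstack one-sided.\<close>

lemma pile_ok_after_pop:
  assumes "pile_ok P" "sorted_wrt (<) L" "sorted_wrt (<) R" "set L \<inter> set R = {}"
    "\<forall>a\<in>set L \<union> set R. \<forall>b\<in>pile_set P. a < b" "b \<or> R = []"
  shows "pile_ok (after_pop b (L, R) P)"
proof (cases "(L, R) = ([], [])")
  case True
  with assms show ?thesis by (simp add: after_pop_def)
next
  case ne: False
  show ?thesis
  proof (cases "b \<and> P = [] \<and> monotonic (L, R)")
    case True
    obtain L' R' where m: "make_one_sided (L, R) = (L', R')" by fastforce
    have "twin_set (L', R') = twin_set (L, R)" using m twin_set_make_one_sided by metis
    then have "(L', R') \<noteq> ([], [])" using ne by auto
    moreover note make_one_sided_sorted[OF conjunct2[OF conjunct2[OF True]] assms(2,3) m]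
    ultimately have "twin_ok (orient (L', R'))" "snd (orient (L', R')) = []"
      using twin_ok_orient[of L' R'] snd_orient[of L' R'] by auto
    with True ne m show ?thesis by (simp add: after_pop_def del: orient.simps)
  next
    case False
    have "twin_ok (orient (L, R))" using twin_ok_orient ne assms by blast
    moreover have "snd (orient (L, R)) = []" if "P = []" "monotonic (orient (L, R))"
      using that False assms(6) snd_orient[of L R] by (auto simp del: orient.simps monotonic.simps)
    ultimately show ?thesis using False ne assms
      by (auto simp add: after_pop_def simp del: orient.simps monotonic.simps)
  qed
qed

text \<open>\<open>c\<close> occurs nowhere else in the pile, so \<open>remove1 c\<close> deletes
  just this stack top in every arrangement.\<close>

lemma arrangements_remove_right:
  assumes "pile_ok ((L, c # R) # P)"
  shows "arrangements ((L, R) # P) = remove1 c ` arrangements ((L, c # R) # P)"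
proof -
  have "c \<notin> set L" "c \<notin> set R" "c \<notin> pile_set P" using assms by auto
  then show ?thesis by (auto simp: image_UN remove1_append remove1_idem set_arrangements)
qed

lemma arrangements_remove_left:
  assumes "pile_ok ((c # L, R) # P)"
  shows "arrangements ((L, R) # P) = remove1 c ` arrangements ((c # L, R) # P)"
proof -
  have "c \<notin> set L" "c \<notin> set R" "c \<notin> pile_set P" using assms by auto
  then show ?thesis by (auto simp: image_UN remove1_append remove1_idem set_arrangements)
qed

lemma completes_arrangements_remove:
  assumes "pile_ok P" "c \<in> pile_set P" "\<forall>y\<in>pile_set P. c \<le> y" "F = out @ c # rest" "distinct F"
    "arrangements Q = remove1 c ` arrangements P"
  shows "(\<exists>d\<in>arrangements Q. completes F (out @ [c], d, inp)) \<longleftrightarrow>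
    (\<exists>d\<in>arrangements P. completes F (out, d, inp))"
proof -
  have "completes F (out, d, inp) \<longleftrightarrow> completes F (out @ [c], remove1 c d, inp)"
    if "d \<in> arrangements P" for d
    using completes_pop_iff[of d c F out rest inp] arrangements_no_valley[OF assms(1) that]
      distinct_arrangements[OF assms(1) that] set_arrangements[OF that] assms by auto
  with assms(6) show ?thesis by auto
qed

text \<open>The loop invariant: \<open>{length out<..n}\<close> is what the output still lacks, so
  no remaining element is below the next required one.\<close>

definition consistent :: "nat \<Rightarrow> nat list \<Rightarrow> pile \<Rightarrow> nat list \<Rightarrow> bool" where
  "consistent n out P inp \<longleftrightarrow> pile_ok P \<and> length out \<le> n \<and> out = [1..<Suc (length out)] \<and>
     pile_set P \<inter> set inp = {} \<and> pile_set P \<union> set inp = {length out<..n} \<and> distinct inp"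

lemma upt_split: "c \<le> n \<Longrightarrow> 1 \<le> c \<Longrightarrow> [1..<Suc n] = [1..<c] @ c # [Suc c..<Suc n]"
  by (metis le_Suc_eq less_Suc_eq_le nat_le_iff_add upt_add_eq_append upt_conv_Cons)

text \<open>Stated for an arbitrary \<open>Q\<close> so that pops from either stack can share
  it.\<close>

lemma consistent_pop:
  assumes "consistent n out P inp" "Suc (length out) \<in> pile_set P"
    "arrangements Q = remove1 (Suc (length out)) ` arrangements P" "pile_ok Q"
    "pile_set Q = pile_set P - {Suc (length out)}"
  shows "consistent n (out @ [Suc (length out)]) Q inp"
    "(\<exists>d\<in>arrangements Q. completes [1..<Suc n] (out @ [Suc (length out)], d, inp)) \<longleftrightarrow>
     (\<exists>d\<in>arrangements P. completes [1..<Suc n] (out, d, inp))"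
proof -
  define c where "c = Suc (length out)"
  have sets: "pile_set P \<union> set inp = {length out<..n}" and out: "out = [1..<c]"
    using assms(1) by (simp_all add: consistent_def c_def)
  have "c \<in> {length out<..n}" using assms(2) sets unfolding c_def by blast
  then have c: "c \<le> n" by simp
  have "out @ [c] = [1..<Suc c]" using out by (simp add: c_def)
  moreover have "pile_set Q \<union> set inp = {c<..n}"
  proof -
    have "c \<notin> set inp" using assms(1,2) by (auto simp: consistent_def c_def)
    then have "pile_set Q \<union> set inp = (pile_set P \<union> set inp) - {c}"
      using assms(5) by (auto simp: c_def)
    also have "\<dots> = {c<..n}" unfolding sets by (auto simp: c_def)
    finally show ?thesis .
  qed
  ultimately show "consistent n (out @ [Suc (length out)]) Q inp"
    using assms(1,4,5) c by (auto simp: consistent_def c_def)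
  have "[1..<Suc n] = out @ c # [Suc c..<Suc n]"
    using upt_split[OF c] out unfolding c_def by (metis le_add1 plus_1_eq_Suc)
  moreover have "\<forall>y\<in>pile_set P. c \<le> y"
  proof
    fix y assume "y \<in> pile_set P"
    then have "y \<in> {length out<..n}" using sets by blast
    then show "c \<le> y" by (simp add: c_def)
  qed
  moreover have "pile_ok P" using assms(1) by (simp add: consistent_def)
  ultimately show "(\<exists>d\<in>arrangements Q. completes [1..<Suc n] (out @ [Suc (length out)], d, inp)) \<longleftrightarrow>
     (\<exists>d\<in>arrangements P. completes [1..<Suc n] (out, d, inp))"
    using completes_arrangements_remove[OF _ assms(2) _ _ distinct_upt assms(3)]
    unfolding c_def by blast
qed

text \<open>The next output is the minimum of what remains, so if it is in the pile at all, it is a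
  top of the top twinstack. The step thus stops only when it is absent.\<close>

lemma consistent_to_output:
  assumes "consistent n out P inp" "to_output out P = (out', P')"
  shows "consistent n out' P' inp \<and> Suc (length out') \<notin> pile_set P' \<and>
    ((\<exists>d\<in>arrangements P'. completes [1..<Suc n] (out', d, inp)) \<longleftrightarrow>
     (\<exists>d\<in>arrangements P. completes [1..<Suc n] (out, d, inp)))"
  using assms
proof (induction out P rule: to_output.induct)
  case (1 out)
  then show ?case by simp
next
  case (2 out L R P)
  let ?c = "Suc (length out)"
  have ok: "pile_ok ((L, R) # P)" using 2(3) by (simp add: consistent_def)
  have tw: "twin_ok (L, R)" and okP: "pile_ok P"
    and blk: "\<forall>a\<in>set L \<union> set R. \<forall>b\<in>pile_set P. a < b"
    using ok by simp_all
  have min: "?c \<le> y" if "y \<in> pile_set ((L, R) # P)" for y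
    using 2(3) that unfolding consistent_def by (metis Suc_leI UnI1 greaterThanAtMost_iff)
  show ?case
  proof (cases "R \<noteq> [] \<and> hd R = ?c")
    case True
    then obtain R' where R: "R = ?c # R'" by (metis list.collapse)
    let ?Q = "after_pop True (L, R') P"
    have "arrangements ?Q = remove1 ?c ` arrangements ((L, R) # P)"
      using arrangements_remove_right[of L ?c R' P] ok
      unfolding R arrangements_after_pop by simp
    moreover have "pile_ok ?Q"
      using tw okP blk R by (intro pile_ok_after_pop) auto
    moreover have "pile_set ?Q = pile_set ((L, R) # P) - {?c}"
      using tw blk R by (auto simp: pile_set_after_pop)
    moreover have "?c \<in> pile_set ((L, R) # P)" using R by simp
    ultimately have step: "consistent n (out @ [?c]) ?Q inp"
      "(\<exists>d\<in>arrangements ?Q. completes [1..<Suc n] (out @ [?c], d, inp)) \<longleftrightarrow>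
        (\<exists>d\<in>arrangements ((L, R) # P). completes [1..<Suc n] (out, d, inp))"
      using consistent_pop[OF 2(3), of ?Q] by blast+
    have "to_output (out @ [?c]) ?Q = (out', P')" using 2(4) R by simp
    with 2(1) step R show ?thesis by simp
  next
    case nR: False
    show ?thesis
    proof (cases "hd L = ?c")
      case True
      with tw obtain L' where L: "L = ?c # L'" by (metis list.collapse twin_ok.simps)
      \<comment> \<open>A right top would be smaller than the left top, hence smaller than the
        minimum. So a left pop meets the condition of \<open>pile_ok_after_pop\<close>.\<close>
      have R: "R = []"
      proof (rule ccontr)
        assume "R \<noteq> []"
        then have "hd R < ?c" "?c \<le> hd R" using tw True min[of "hd R"] by auto
        then show False by simp
      qed
      let ?Q = "after_pop False (L', R) P"
      have "arrangements ?Q = remove1 ?c ` arrangements ((L, R) # P)"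
        using arrangements_remove_left[of ?c L' R P] ok
        unfolding L arrangements_after_pop by simp
      moreover have "pile_ok ?Q"
        using tw okP blk L R by (intro pile_ok_after_pop) auto
      moreover have "pile_set ?Q = pile_set ((L, R) # P) - {?c}"
        using tw blk L R by (auto simp: pile_set_after_pop)
      moreover have "?c \<in> pile_set ((L, R) # P)" using L by simp
      ultimately have step: "consistent n (out @ [?c]) ?Q inp"
        "(\<exists>d\<in>arrangements ?Q. completes [1..<Suc n] (out @ [?c], d, inp)) \<longleftrightarrow>
          (\<exists>d\<in>arrangements ((L, R) # P). completes [1..<Suc n] (out, d, inp))"
        using consistent_pop[OF 2(3), of ?Q] by blast+
      have "to_output (out @ [?c]) ?Q = (out', P')" using 2(4) L R by simp
      with 2(2) step L R show ?thesis by simp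
    next
      case nL: False
      \<comment> \<open>The tops are at least \<open>?c\<close> and differ from it, so they exceed
        it, and with them everything deeper.\<close>
      have "y \<noteq> ?c" if "y \<in> set L" for y
        using sorted_hd_le[of L y] that tw nL min[of "hd L"] by fastforce
      moreover have "y \<noteq> ?c" if "y \<in> set R" for y
      proof -
        have "hd R \<in> set R" using that by (cases R) auto
        then show ?thesis using sorted_hd_le[of R y] that tw nR min[of "hd R"] by fastforce
      qed
      moreover have "y \<noteq> ?c" if "y \<in> pile_set P" for y
      proof -
        have "hd L < y" "?c \<le> hd L" using that blk tw min[of "hd L"] by auto
        then show ?thesis by simp
      qed
      ultimately have "?c \<notin> pile_set ((L, R) # P)" by auto
      moreover have "out' = out" "P' = (L, R) # P" using 2(4) nL nR by (auto simp: Let_def split: if_splits)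
      ultimately show ?thesis using 2(3) by simp
    qed
  qed
qed

section \<open>Correctness\<close>

text \<open>Pushing, normalizing and outputting each preserve whether some represented deque can be
  completed. The second premise forces the next move to be a push.\<close>

lemma rtm_loop_iff:
  assumes "consistent n out P inp" "Suc (length out) \<notin> pile_set P"
  shows "rtm_loop out P inp \<longleftrightarrow> (\<exists>d\<in>arrangements P. completes [1..<Suc n] (out, d, inp))"
  using assms
proof (induction inp arbitrary: out P)
  case Nil
  then have sets: "pile_set P = {length out<..n}" and out: "out = [1..<Suc (length out)]"
    and "length out \<le> n" "pile_ok P"
    by (simp_all add: consistent_def)
  \<comment> \<open>The input is exhausted, so a missing next output would have to be in the
    pile.\<close>
  with Nil(2) have "length out = n" by auto
  moreover from this have "P = []"
    using sets \<open>pile_ok P\<close> by (cases P) (auto elim!: twin_ok.elims)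
  moreover have "out = [1..<Suc n]" using out \<open>length out = n\<close> by simp
  ultimately show ?case by (simp add: completes_def)
next
  case (Cons x inp)
  note cons = Cons.prems(1)[unfolded consistent_def]
  let ?F = "[1..<Suc n]"
  have ok: "pile_ok P" and x: "x \<notin> pile_set P" using cons by auto
  have "pile_set P \<union> set (x # inp) = {length out<..n}" using cons by blast
  then have "x \<in> {length out<..n}" by (metis UnI2 list.set_intros(1))
  then have "Suc (length out) \<le> n" by simp
  then have F: "?F = out @ Suc (length out) # [Suc (Suc (length out))..<Suc n]"
    using upt_split[of "Suc (length out)" n] cons by (metis One_nat_def Suc_le_mono le0)
  \<comment> \<open>The two orientations of the new twinstack are the two ends at which
    \<open>x\<close> can be pushed.\<close>
  have push: "(\<exists>d\<in>arrangements P. completes ?F (out, d, x # inp)) \<longleftrightarrow>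
      (\<exists>d\<in>arrangements (([x], []) # P). completes ?F (out, d, inp))"
  proof
    assume "\<exists>d\<in>arrangements P. completes ?F (out, d, x # inp)"
    then obtain d where d: "d \<in> arrangements P" "completes ?F (out, d, x # inp)" by blast
    have "Suc (length out) \<notin> set d" using d(1) Cons.prems(2) set_arrangements by blast
    then have "completes ?F (out, x # d, inp) \<or> completes ?F (out, d @ [x], inp)"
      using completes_push[OF d(2) F] by blast
    with d(1) show "\<exists>d\<in>arrangements (([x], []) # P). completes ?F (out, d, inp)" by auto
  next
    assume "\<exists>d\<in>arrangements (([x], []) # P). completes ?F (out, d, inp)"
    then obtain d e where d: "d \<in> arrangements P" "e = x # d \<or> e = d @ [x]"
      "completes ?F (out, e, inp)" by auto
    then have "deque_step (out, d, x # inp) (out, e, inp)"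
      by (auto intro: deque_step.intros)
    with d(3) have "completes ?F (out, d, x # inp)"
      unfolding completes_def by (rule converse_rtranclp_into_rtranclp[rotated])
    with d(1) show "\<exists>d\<in>arrangements P. completes ?F (out, d, x # inp)" by blast
  qed
  \<comment> \<open>A deque with a valley has no completing run, so filtering does not change the
    existence statement.\<close>
  also have "\<dots> \<longleftrightarrow> (\<exists>d\<in>arrangements (([x], []) # P) \<inter> valley_free. completes ?F (out, d, inp))"
    using completes_no_valley[OF _ sorted_wrt_upt] unfolding valley_free_def by blast
  finally have reach: "(\<exists>d\<in>arrangements P. completes ?F (out, d, x # inp)) \<longleftrightarrow>
    (\<exists>d\<in>arrangements (([x], []) # P) \<inter> valley_free. completes ?F (out, d, inp))" .
  note spec = normalize_spec[OF ok, of x "[]"]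
  show ?case
  proof (cases "normalize (([x], []) # P)")
    case None
    with spec x have "arrangements (([x], []) # P) \<inter> valley_free = {}" by simp
    with None reach show ?thesis by simp
  next
    case (Some Q)
    with spec x have Q: "pile_ok Q" "pile_set Q = insert x (pile_set P)"
      "arrangements Q = arrangements (([x], []) # P) \<inter> valley_free" by simp_all
    have consQ: "consistent n out Q inp"
      using cons Q(1,2) unfolding consistent_def by auto
    obtain out' P' where out: "to_output out Q = (out', P')" by fastforce
    have "rtm_loop out' P' inp \<longleftrightarrow> (\<exists>d\<in>arrangements P'. completes ?F (out', d, inp))"
      using Cons.IH consistent_to_output[OF consQ out] by blast
    with consistent_to_output[OF consQ out] reach Q(3) Some out show ?thesis by simp
  qed
qed

theorem theorem5p4:
  fixes n :: nat and p :: "nat list"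
  assumes "p \<in> permutations_of_set {1..n}"
  shows "rtm p \<longleftrightarrow> deque_sortable p"
proof -
  have p: "set p = {1..n}" "distinct p" using assms by (auto simp: permutations_of_set_def)
  then have len: "length p = n" using distinct_card[of p] by simp
  have m: "mset p = mset [1..<Suc n]"
    using p set_eq_iff_mset_eq_distinct[of p "[1..<Suc n]"]
    by (simp add: atLeastLessThanSuc_atLeastAtMost del: upt_Suc)
  \<comment> \<open>The output already contains all elements, and steps preserve the
    multiset.\<close>
  have "d = [] \<and> inp = []"
    if "deque_step\<^sup>*\<^sup>* ([], [], p) ([1..<Suc n], d, inp)" for d inp
    using deque_steps_mset[OF that] unfolding fst_conv snd_conv mset_append m by simp
  then have "deque_sortable p \<longleftrightarrow> completes [1..<Suc n] ([], [], p)"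
    unfolding deque_sortable_def completes_def len by metis
  moreover have "{1..n} = {0<..n}" by auto
  then have "consistent n [] [] p" unfolding consistent_def using p by simp
  then have "rtm p \<longleftrightarrow> (\<exists>d\<in>arrangements []. completes [1..<Suc n] ([], d, p))"
    unfolding rtm_def by (rule rtm_loop_iff) simp
  ultimately show ?thesis by simp
qed

end
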